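(* Let $\alpha$ be an umbra with real moments, $t\ge0$, and let $Q_k(x,t)=E[(x-t\mathbf{.}\alpha)^k]$ for nonnegative integers $k$. Then for all $k$ $$Q_k(x,t)=Y_k(x+h_1,h_2,\ldots,h_k),$$ where $Y_k$ are the complete exponential Bell polynomials and $\{h_n\}_{n\ge1}$ is the sequence of (formal) cumulants of $-t\mathbf{.}\alpha$.
   Context: An umbra $\alpha$ is a symbol representing a sequence $a_0=1,a_1,a_2,\ldots$ of real numbers through a linear evaluation functional $E$ with $E[\alpha^n]=a_n$ (the $n$-th moment); $E$ is linear over $\mathbb{R}[x]$ and $E[1]=1$. For $t\in\mathbb{R}$, $t\mathbf{.}\alpha$ is the auxiliary umbra with moments $E[(t\mathbf{.}\alpha)^0]=1$ and $E[(t\mathbf{.}\alpha)^i]=\sum_{m=1}^i (t)_m B_{i,m}(a_1,\ldots,a_{i-m+1})$ for $i\ge1$, where $(t)_m=t(t-1)\cdots(t-m+1)$ and $B_{i,m}$ are the partial exponential Bell polynomials. Equivalently, $\sum_i E[(t\mathbf{.}\alpha)^i]z^i/i!=\big(\sum_n a_n z^n/n!\big)^t$ as formal power series. $-t\mathbf{.}\alpha$ is obtained by replacing $t$ with $-t$, and $x-t\mathbf{.}\alpha$ means $x+(-t\mathbf{.}\alpha)$; powers of it are expanded by the binomial theorem and evaluated linearly with $E$. The formal cumulants $\{h_n\}_{n\ge1}$ of an umbra with moments $\{m_n\}_{n\ge 0}$ are defined by $1+\sum_{n\ge1}m_n z^n/n!=\exp\big(\sum_{n\ge1}h_n z^n/n!\big)$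 as formal power series. The complete exponential Bell polynomials are $Y_0=1$, $Y_k(y_1,\ldots,y_k)=\sum_{i=1}^k B_{k,i}(y_1,\ldots,y_{k-i+1})$, i.e. $\sum_{k\ge0}Y_k(y_1,\ldots,y_k)z^k/k!=\exp\big(\sum_{n\ge1}y_nz^n/n!\big)$. *)

theory Defs
  imports
    "HOL-Library.FuncSet"
    "HOL-Computational_Algebra.Polynomial"
    "HOL-Computational_Algebra.Formal_Power_Series"
begin

section \<open>Exponential Bell polynomials\<close>

text \<open>
  The partial polynomial \<open>B\<^bsub>n,m\<^esub>(y\<^sub>1, \<dots>, y\<^bsub>n-m+1\<^esub>)\<close> is the sum of
  \<open>n! / (\<Prod>\<^sub>l j\<^sub>l! (l!)^j\<^sub>l) * \<Prod>\<^sub>l y\<^sub>l^j\<^sub>l\<close> over all families of naturals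
  \<open>(j\<^sub>l)\<close>, \<open>1 \<le> l \<le> n-m+1\<close>, with \<open>\<Sum>\<^sub>l j\<^sub>l = m\<close> and \<open>\<Sum>\<^sub>l l * j\<^sub>l = n\<close>.
  The coefficient is a natural number, and the division below is exact
  (lemma \<open>bell_coeff_exact\<close>); this makes sense of the polynomials in every commutative
  ring, in particular in the reals and in the ring of real polynomials.
  For \<open>m > n\<close> the truncated \<open>n - m + 1\<close> is \<open>1\<close> and the index set is empty.
  The argument \<open>y\<close> is only used at indices \<open>l \<ge> 1\<close>.
\<close>

definition bell_index :: "nat \<Rightarrow> nat \<Rightarrow> (nat \<Rightarrow> nat) set" where
  "bell_index n m =
     {j \<in> {1..n - m + 1} \<rightarrow>\<^sub>E {0..m}.
        (\<Sum>l = 1..n - m + 1. j l) = m \<and> (\<Sum>l = 1..n - m + 1. l * j l) = n}"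

definition partial_bell :: "nat \<Rightarrow> nat \<Rightarrow> (nat \<Rightarrow> 'a::comm_ring_1) \<Rightarrow> 'a" where
  "partial_bell n m y =
     (\<Sum>j \<in> bell_index n m.
        of_nat (fact n div (\<Prod>l = 1..n - m + 1. fact (j l) * fact l ^ j l)) *
        (\<Prod>l = 1..n - m + 1. y l ^ j l))"

definition complete_bell :: "nat \<Rightarrow> (nat \<Rightarrow> 'a::comm_ring_1) \<Rightarrow> 'a" where
  "complete_bell k y = (if k = 0 then 1 else (\<Sum>i = 1..k. partial_bell k i y))"

lemma fact_mult_fact_power_dvd:
  assumes "l \<ge> 1"
  shows "fact j * fact l ^ j dvd (fact (l * j) :: nat)"
proof (induction j)
  case 0
  show ?case by simp
next
  case (Suc j)
  obtain l' where l: "l = Suc l'" using assms by (cases l) auto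
  have "l * (l * Suc j choose l) = (l * Suc j) * (l * Suc j - 1 choose l')"
    unfolding l by (rule binomial_absorption)
  then have "(l * Suc j choose l) = Suc j * (l * Suc j - 1 choose l')"
    using assms by (metis mult.assoc mult_left_cancel not_one_le_zero)
  moreover have "fact l * fact (l * Suc j - l) * (l * Suc j choose l) = (fact (l * Suc j) :: nat)"
    by (rule binomial_fact_lemma) simp
  moreover have "l * Suc j - l = l * j" by simp
  ultimately have eq: "fact (l * Suc j) =
      (Suc j * fact l * fact (l * j)) * (l * Suc j - 1 choose l')"
    by (metis mult.assoc mult.commute)
  have "fact (Suc j) * fact l ^ Suc j = Suc j * fact l * (fact j * fact l ^ j :: nat)"
    by (simp add: algebra_simps)
  also have "\<dots> dvd Suc j * fact l * fact (l * j)"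
    by (rule mult_dvd_mono[OF dvd_refl Suc.IH])
  finally show ?case unfolding eq by (rule dvd_mult2)
qed

lemma bell_coeff_exact:
  assumes "j \<in> bell_index n m"
  shows "(\<Prod>l = 1..n - m + 1. fact (j l) * fact l ^ j l) dvd (fact n :: nat)"
proof -
  have "(\<Prod>l\<in>A. fact (j l) * fact l ^ j l) dvd (fact (\<Sum>l\<in>A. l * j l) :: nat)"
    if "finite A" "\<forall>l\<in>A. l \<ge> 1" for A
    using that
  proof (induction A rule: finite_induct)
    case (insert x A)
    have "(fact (j x) * fact x ^ j x) * (\<Prod>l\<in>A. fact (j l) * fact l ^ j l) dvd
        (fact (x * j x) * fact (\<Sum>l\<in>A. l * j l) :: nat)"
      using insert by (intro mult_dvd_mono fact_mult_fact_power_dvd) auto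
    also have "\<dots> dvd fact (x * j x + (\<Sum>l\<in>A. l * j l))"
      by (rule fact_fact_dvd_fact)
    finally show ?case using insert by simp
  qed simp
  from this[of "{1..n - m + 1}"] show ?thesis
    using assms by (simp add: bell_index_def)
qed


section \<open>Umbrae\<close>

text \<open>
  An umbra is represented by its sequence of moments \<open>a :: nat \<Rightarrow> real\<close> with \<open>a 0 = 1\<close>.
  A polynomial in one umbra \<open>\<gamma>\<close> with coefficients in \<open>\<real>[x]\<close> is an element of
  \<^typ>\<open>real poly poly\<close>: the outer variable is \<open>\<gamma>\<close>, the inner one is \<open>x\<close>.
  \<open>umbral_eval a\<close> is the evaluation \<open>E\<close>, i.e. the \<open>\<real>[x]\<close>-linear map with
  \<open>\<gamma>^i \<mapsto> a i\<close> when \<open>\<gamma>\<close> has moments \<open>a\<close>.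
\<close>

definition umbral_eval :: "(nat \<Rightarrow> real) \<Rightarrow> real poly poly \<Rightarrow> real poly" where
  "umbral_eval a p = (\<Sum>i\<le>degree p. coeff p i * [:a i:])"

text \<open>The moments of \<open>t.\<alpha>\<close>; the product is the falling factorial \<open>(t)\<^sub>m\<close>.\<close>

definition umbral_dot :: "real \<Rightarrow> (nat \<Rightarrow> real) \<Rightarrow> nat \<Rightarrow> real" where
  "umbral_dot t a i =
     (if i = 0 then 1 else (\<Sum>m = 1..i. (\<Prod>r<m. t - real r) * partial_bell i m a))"

text \<open>
  \<open>Q k a t\<close> is \<open>Q\<^sub>k(x,t) = E[(x - t.\<alpha>)^k]\<close> as a polynomial in \<open>x\<close>. The polynomial
  \<open>[:[:0, 1:], 1:]\<close> is \<open>x + \<gamma>\<close>, and \<open>\<gamma>\<close> is the umbra \<open>-t.\<alpha>\<close>.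
\<close>

definition Q :: "nat \<Rightarrow> (nat \<Rightarrow> real) \<Rightarrow> real \<Rightarrow> real poly" where
  "Q k a t = umbral_eval (umbral_dot (- t) a) ([:[:0, 1:], 1:] ^ k)"

text \<open>
  Cumulants are indexed from \<open>1\<close>, so the value \<open>h 0\<close> is irrelevant.
\<close>

definition formal_cumulants :: "(nat \<Rightarrow> real) \<Rightarrow> (nat \<Rightarrow> real) \<Rightarrow> bool" where
  "formal_cumulants a h \<longleftrightarrow>
     Abs_fps (\<lambda>n. a n / fact n) =
     fps_exp 1 oo Abs_fps (\<lambda>n. if n = 0 then 0 else h n / fact n)"

lemma formal_cumulants_exists:
  assumes "a 0 = 1"
  shows "\<exists>h. formal_cumulants a h"
proof -
  define F where "F = Abs_fps (\<lambda>n. a n / fact n)"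
  define G where "G = fps_ln 1 oo (F - 1)"
  have F0: "fps_nth (F - 1) 0 = 0" using assms by (simp add: F_def)
  have "(fps_exp 1 - 1) oo G = (fps_exp 1 - 1) oo fps_ln 1 oo (F - 1)"
    unfolding G_def by (rule fps_compose_assoc[OF F0]) simp
  also have "(fps_exp 1 - 1) oo fps_ln 1 = (fps_X :: real fps)"
    unfolding fps_ln_fps_exp_inv[OF one_neq_zero] by (rule fps_inv_right) simp_all
  finally have "(fps_exp 1 oo G) = F"
    using F0 by (simp add: fps_compose_sub_distrib)
  moreover have "Abs_fps (\<lambda>n. if n = 0 then 0 else fps_nth G n * fact n / fact n) = G"
    by (rule fps_ext) (simp add: G_def)
  ultimately have "formal_cumulants a (\<lambda>n. fps_nth G n * fact n)"
    by (simp add: formal_cumulants_def F_def)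
  then show ?thesis by blast
qed

lemma formal_cumulants_unique:
  assumes "formal_cumulants a h" "formal_cumulants a h'" "n \<ge> 1"
  shows "h n = h' n"
proof -
  define G where "G h = Abs_fps (\<lambda>n. if n = 0 then 0 else h n / fact n)" for h :: "nat \<Rightarrow> real"
  have inv: "fps_ln 1 oo ((fps_exp 1 oo G h) - 1) = G h" for h
  proof -
    have G0: "fps_nth (G h) 0 = 0" by (simp add: G_def)
    have "fps_ln 1 oo ((fps_exp 1 - 1) oo G h) = fps_ln 1 oo (fps_exp 1 - 1) oo G h"
      by (rule fps_compose_assoc[OF G0]) simp
    also have "fps_ln 1 oo (fps_exp 1 - 1) = (fps_X :: real fps)"
      unfolding fps_ln_fps_exp_inv[OF one_neq_zero] by (rule fps_inv) simp_all
    finally show ?thesis using G0 by (simp add: fps_compose_sub_distrib)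
  qed
  have "fps_exp 1 oo G h = fps_exp 1 oo G h'"
    using assms(1,2) by (simp add: formal_cumulants_def G_def)
  then have "G h = G h'" using inv by metis
  then have "fps_nth (G h) n = fps_nth (G h') n" by simp
  then show ?thesis using assms(3) by (simp add: G_def)
qed

end

theory Submission
  imports Defs
begin

text \<open>
  After evaluating the polynomial variable at a real number, everything is a statement on real power
  series. Grouping the factors of \<open>exp (\<Sum>\<^sub>l y\<^sub>l z\<^sup>l / l!) = \<Prod>\<^sub>l exp (y\<^sub>l z\<^sup>l / l!)\<close> by multiplicities
  shows that it is the exponential generating function of the complete Bell polynomials. Adding \<open>x\<close>
  to the first argument multiplies this series by \<open>exp (x z)\<close>, which is the binomial expansion of
  \<open>E[(x + \<gamma>)^k]\<close> for the umbra \<open>\<gamma>\<close> with cumulants \<open>h\<close>.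
\<close>

section \<open>Exponentials of formal power series\<close>

text \<open>Multiplied by exp (-F), a solution of K' = K F' with constant term 1 has derivative 0,
  so the product is 1. Both \<open>H\<close> and exp F are such solutions, and exp (-F) can be
  cancelled.\<close>

lemma fps_exp_compose_unique:
  fixes F H :: "'a::field_char_0 fps"
  assumes "fps_nth F 0 = 0" "fps_nth H 0 = 1" "fps_deriv H = H * fps_deriv F"
  shows "H = fps_exp 1 oo F"
proof -
  \<comment> \<open>Kept general in \<open>K\<close> because it serves for \<open>H\<close> and for
    exp F.\<close>
  have inverse: "K * (fps_exp 1 oo (- F)) = 1"
    if "fps_nth K 0 = 1" "fps_deriv K = K * fps_deriv F" for K
  proof -
    have "fps_deriv (K * (fps_exp 1 oo (- F))) = 0"
      using assms(1) that(2) by (simp add: fps_compose_deriv algebra_simps)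
    then have "K * (fps_exp 1 oo (- F)) = fps_const (fps_nth (K * (fps_exp 1 oo (- F))) 0)"
      by (simp only: fps_deriv_eq_0_iff)
    then show ?thesis using that(1) by simp
  qed
  have "H * (fps_exp 1 oo (- F)) = (fps_exp 1 oo F) * (fps_exp 1 oo (- F))"
    using assms by (simp add: inverse fps_compose_deriv)
  moreover have "fps_exp 1 oo (- F) \<noteq> 0"
    using inverse[OF assms(2,3)] by auto
  ultimately show ?thesis by simp
qed

lemma fps_exp_compose_add:
  fixes F G :: "'a::field_char_0 fps"
  assumes "fps_nth F 0 = 0" "fps_nth G 0 = 0"
  shows "fps_exp 1 oo (F + G) = (fps_exp 1 oo F) * (fps_exp 1 oo G)"
  using assms
  by (intro fps_exp_compose_unique[symmetric]) (simp_all add: fps_compose_deriv algebra_simps)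

lemma fps_exp_compose_sum:
  fixes F :: "'b \<Rightarrow> 'a::field_char_0 fps"
  assumes "finite A" "\<And>l. l \<in> A \<Longrightarrow> fps_nth (F l) 0 = 0"
  shows "fps_exp 1 oo (\<Sum>l\<in>A. F l) = (\<Prod>l\<in>A. fps_exp 1 oo F l)"
  using assms
proof (induction A rule: finite_induct)
  case (insert x A)
  then show ?case by (simp add: fps_exp_compose_add fps_sum_nth)
qed simp

lemma fps_power_nth_cong:
  fixes F G :: "'a::comm_ring_1 fps"
  assumes "\<And>i. i \<le> n \<Longrightarrow> fps_nth F i = fps_nth G i" "k \<le> n"
  shows "fps_nth (F ^ m) k = fps_nth (G ^ m) k"
  using assms(2) by (induction m arbitrary: k) (simp_all add: fps_mult_nth assms(1))

text \<open>Allows the exponent to be truncated at degree n when only the n-th coefficient is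
  wanted.\<close>

lemma fps_compose_nth_cong:
  fixes F G :: "'a::comm_ring_1 fps"
  assumes "\<And>i. i \<le> n \<Longrightarrow> fps_nth F i = fps_nth G i"
  shows "fps_nth (H oo F) n = fps_nth (H oo G) n"
  using fps_power_nth_cong[of n F G n] assms by (simp add: fps_compose_nth)

lemma fps_exp_compose_monom_nth:
  fixes c :: "'a::field_char_0"
  assumes "l > 0"
  shows "fps_nth (fps_exp 1 oo (fps_const c * fps_X ^ l)) n =
    (if l dvd n then c ^ (n div l) / fact (n div l) else 0)"
proof -
  have "fps_nth (fps_exp 1 oo (fps_const c * fps_X ^ l)) n =
      (\<Sum>i=0..n. if n = l * i then c ^ i / fact i else 0)"
    unfolding fps_compose_nth
    by (rule sum.cong) (auto simp: power_mult_distrib fps_const_power power_mult[symmetric])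
  also have "\<dots> = (\<Sum>i=0..n. if i = n div l \<and> l dvd n then c ^ i / fact i else 0)"
    using assms by (intro sum.cong) (auto elim!: dvdE)
  also have "\<dots> = (if l dvd n then c ^ (n div l) / fact (n div l) else 0)"
    by (cases "l dvd n") simp_all
  finally show ?thesis .
qed

section \<open>Coefficients of a finite product of exponentials of monomials\<close>

text \<open>Multiplicity families of total weight n. In contrast to \<open>bell_index\<close>, the
  number of parts is left free and the set of part sizes is arbitrary, which permits induction on
  \<open>A\<close>.\<close>

definition weighted_families :: "nat set \<Rightarrow> nat \<Rightarrow> (nat \<Rightarrow> nat) set" where
  "weighted_families A n = {j \<in> A \<rightarrow>\<^sub>E {0..n}. (\<Sum>l\<in>A. l * j l) = n}"

lemma finite_weighted_families: "finite A \<Longrightarrow> finite (weighted_families A n)"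
  by (simp add: weighted_families_def finite_PiE)

lemma weight_le:
  fixes j :: "nat \<Rightarrow> nat"
  assumes "finite A" "0 \<notin> A" "l \<in> A"
  shows "j l \<le> (\<Sum>l\<in>A. l * j l)"
proof -
  have "j l \<le> l * j l" using assms by (cases l) auto
  also have "\<dots> \<le> (\<Sum>l\<in>A. l * j l)"
    by (rule member_le_sum) (use assms in auto)
  finally show ?thesis .
qed

lemma weighted_families_iff:
  assumes "finite A" "0 \<notin> A"
  shows "j \<in> weighted_families A n \<longleftrightarrow> j \<in> extensional A \<and> (\<Sum>l\<in>A. l * j l) = n"
  using weight_le[OF assms] by (auto simp: weighted_families_def PiE_iff)

text \<open>Induction on \<open>A\<close>: in the Cauchy product with the factor for a new size x,
  the exponent taken from that factor is the weight x * j x contributed by the parts of size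
  x.\<close>

lemma fps_prod_exp_monom_nth:
  fixes c :: "nat \<Rightarrow> 'a::field_char_0"
  assumes "finite A" "0 \<notin> A"
  shows "fps_nth (\<Prod>l\<in>A. fps_exp 1 oo (fps_const (c l) * fps_X ^ l)) n =
    (\<Sum>j\<in>weighted_families A n. \<Prod>l\<in>A. c l ^ j l / fact (j l))"
  using assms
proof (induction A arbitrary: n rule: finite_induct)
  case empty
  have "weighted_families {} n = (if n = 0 then {\<lambda>_. undefined} else {})"
    by (auto simp: weighted_families_def)
  then show ?case by simp
next
  case (insert x A)
  let ?w = "\<lambda>A j. \<Prod>l\<in>A. c l ^ j l / fact (j l)"
  let ?I = "{i\<in>{0..n}. x dvd i}"
  have x: "x > 0" and A: "0 \<notin> A" using insert.prems by auto
  have "fps_nth (\<Prod>l\<in>insert x A. fps_exp 1 oo (fps_const (c l) * fps_X ^ l)) n =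
      (\<Sum>i=0..n. (if x dvd i then c x ^ (i div x) / fact (i div x) else 0) *
        (\<Sum>j\<in>weighted_families A (n - i). ?w A j))"
    using insert.hyps x insert.IH[OF A]
    by (simp add: fps_mult_nth fps_exp_compose_monom_nth)
  also have "\<dots> = (\<Sum>i\<in>?I. \<Sum>j\<in>weighted_families A (n - i).
      c x ^ (i div x) / fact (i div x) * ?w A j)"
    by (rule sum.mono_neutral_cong_right) (auto simp: sum_distrib_left)
  also have "\<dots> = (\<Sum>(i, j)\<in>Sigma ?I (\<lambda>i. weighted_families A (n - i)).
      c x ^ (i div x) / fact (i div x) * ?w A j)"
    by (rule sum.Sigma) (simp_all add: finite_weighted_families insert.hyps)
  also have "\<dots> = (\<Sum>j\<in>weighted_families (insert x A) n. ?w (insert x A) j)"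
  \<comment> \<open>A pair (i, j) with x dividing i becomes the family with multiplicity i div x at
    x; conversely x is reset to \<open>undefined\<close>, so that the rest is extensional on
    \<open>A\<close>.\<close>
  proof (rule sum.reindex_bij_witness
      [where i = "\<lambda>j. (x * j x, j(x := undefined))" and j = "\<lambda>(i, j). j(x := i div x)"], goal_cases)
    case (1 p)
    then show ?case using insert.hyps
      by (auto simp: weighted_families_iff[OF insert.hyps(1) A] extensional_def fun_eq_iff)
  next
    case (2 p)
    obtain i j where p: "p = (i, j)" by (cases p)
    have "(\<Sum>l\<in>A. l * (j(x := i div x)) l) = (\<Sum>l\<in>A. l * j l)"
      by (rule sum.cong) (use insert.hyps in auto)
    then show ?case using insert.hyps insert.prems 2 p
      by (auto simp: weighted_families_iff extensional_def simp del: fun_upd_apply) auto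
  next
    case (3 j)
    then show ?case using x by auto
  next
    case (4 j)
    have "(\<Sum>l\<in>A. l * (j(x := undefined)) l) = (\<Sum>l\<in>A. l * j l)"
      by (rule sum.cong) (use insert.hyps in auto)
    then show ?case using insert.hyps insert.prems 4
      by (auto simp: weighted_families_iff extensional_def)
  next
    case (5 p)
    obtain i j where p: "p = (i, j)" by (cases p)
    have "?w A (j(x := i div x)) = ?w A j"
      by (rule prod.cong) (use insert.hyps in auto)
    then show ?case using insert.hyps p by simp
  qed
  finally show ?case .
qed

section \<open>From Bell index sets to weighted families\<close>

text \<open>Weight minus number of parts is the sum of (l - 1) * j l, which is n - m; a single part
  of size i already contributes i - 1 > n - m.\<close>

lemma large_part_eq_0:
  fixes j :: "nat \<Rightarrow> nat"
  assumes "(\<Sum>l=1..n. j l) = m" "(\<Sum>l=1..n. l * j l) = n" "i \<in> {1..n}" "i > n - m + 1"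
  shows "j i = 0"
proof (rule ccontr)
  assume ne: "j i \<noteq> 0"
  have "(i - 1) * j i \<le> (\<Sum>l=1..n. (l - 1) * j l)"
    by (rule member_le_sum[where f = "\<lambda>l. (l - 1) * j l"]) (use assms in auto)
  moreover have "(\<Sum>l=1..n. (l - 1) * j l) + (\<Sum>l=1..n. j l) = (\<Sum>l=1..n. l * j l)"
    unfolding sum.distrib[symmetric]
    by (rule sum.cong) (auto simp: algebra_simps diff_mult_distrib)
  moreover have "i - 1 \<le> (i - 1) * j i" using ne by simp
  ultimately show False using assms by linarith
qed

text \<open>Families of weight n are sorted by their number m of parts. Sizes above n - m + 1 have
  multiplicity 0, and \<open>f l 0 = 1\<close> makes their factors trivial.\<close>

lemma sum_bell_index:
  fixes f :: "nat \<Rightarrow> nat \<Rightarrow> 'a::comm_ring_1"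
  assumes "n \<ge> 1" "\<And>l. f l 0 = 1"
  shows "(\<Sum>m=1..n. \<Sum>j\<in>bell_index n m. \<Prod>l=1..n - m + 1. f l (j l)) =
    (\<Sum>j\<in>weighted_families {1..n} n. \<Prod>l=1..n. f l (j l))"
proof -
  \<comment> \<open>Mutually inverse maps between the two index sets: \<open>ext\<close> pads a
    family with zeros up to n, \<open>cut\<close> recovers m as the number of parts and restricts to
    sizes up to n - m + 1.\<close>
  define ext where
    "ext p = (\<lambda>l\<in>{1..n}. if l \<le> n - fst p + 1 then snd p l else 0)" for p :: "nat \<times> (nat \<Rightarrow> nat)"
  define cut where
    "cut j = ((\<Sum>l=1..n. j l), restrict j {1..n - (\<Sum>l=1..n. j l) + 1})" for j :: "nat \<Rightarrow> nat"
  have fin: "finite (bell_index n m)" for m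
    by (simp add: bell_index_def finite_PiE)
  have sum_ext: "(\<Sum>l=1..n. g l (ext (m, j) l)) = (\<Sum>l=1..n - m + 1. g l (j l))"
    if "m \<in> {1..n}" "\<And>l. g l 0 = 0" for g :: "nat \<Rightarrow> nat \<Rightarrow> nat" and m j
    by (rule sum.mono_neutral_cong_right) (use that in \<open>auto simp: ext_def\<close>)
  have prod_ext: "(\<Prod>l=1..n. f l (ext (m, j) l)) = (\<Prod>l=1..n - m + 1. f l (j l))"
    if "m \<in> {1..n}" for m j
    by (rule prod.mono_neutral_cong_right) (use that assms in \<open>auto simp: ext_def\<close>)
  have "(\<Sum>m=1..n. \<Sum>j\<in>bell_index n m. \<Prod>l=1..n - m + 1. f l (j l)) =
      (\<Sum>(m, j)\<in>Sigma {1..n} (bell_index n). \<Prod>l=1..n - m + 1. f l (j l))"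
    by (rule sum.Sigma) (simp_all add: fin)
  also have "\<dots> = (\<Sum>j\<in>weighted_families {1..n} n. \<Prod>l=1..n. f l (j l))"
  proof (rule sum.reindex_bij_witness[where i = cut and j = ext], goal_cases)
    case (1 p)
    obtain m j where p: "p = (m, j)" by (cases p)
    have m: "m \<in> {1..n}" and j: "j \<in> bell_index n m" using 1 p by auto
    have s: "(\<Sum>l=1..n. ext p l) = m"
      using sum_ext[OF m, of "\<lambda>_ i. i" j] j p by (simp add: bell_index_def)
    have "restrict (ext p) {1..n - m + 1} = j"
    proof
      fix l
      show "restrict (ext p) {1..n - m + 1} l = j l"
        using m j p by (cases "l \<in> {1..n - m + 1}")
          (auto simp: ext_def bell_index_def PiE_iff extensional_def)
    qed
    then show ?case using s p by (simp add: cut_def)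
  next
    case (2 p)
    obtain m j where p: "p = (m, j)" by (cases p)
    have m: "m \<in> {1..n}" and j: "j \<in> bell_index n m" using 2 p by auto
    have "(\<Sum>l=1..n. l * ext p l) = n"
      using sum_ext[OF m, of "\<lambda>l i. l * i" j] j p by (simp add: bell_index_def)
    moreover have "ext p \<in> extensional {1..n}" by (simp add: ext_def)
    ultimately show ?case by (simp add: weighted_families_iff)
  next
    case (3 j)
    define m where "m = (\<Sum>l=1..n. j l)"
    have j: "j \<in> extensional {1..n}" "(\<Sum>l=1..n. l * j l) = n"
      using 3 by (auto simp: weighted_families_iff)
    have "cut j = (m, restrict j {1..n - m + 1})" by (simp add: cut_def m_def)
    then have "ext (cut j) l = j l" for l
      using j large_part_eq_0[OF m_def[symmetric] j(2), of l]
      by (auto simp: ext_def extensional_def)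
    then show ?case by auto
  next
    case (4 j)
    define m where "m = (\<Sum>l=1..n. j l)"
    have j: "j \<in> extensional {1..n}" "(\<Sum>l=1..n. l * j l) = n"
      using 4 by (auto simp: weighted_families_iff)
    have "m \<le> (\<Sum>l=1..n. l * j l)"
      unfolding m_def by (rule sum_mono) simp
    then have "m \<le> n" by (simp only: j(2))
    \<comment> \<open>The outer sum starts at m = 1; a family without parts has weight 0, which n
      \<ge> 1 excludes.\<close>
    moreover have "m \<noteq> 0"
    proof
      assume "m = 0"
      then have "(\<Sum>l=1..n. l * j l) = 0" by (simp add: m_def)
      then show False using j(2) assms(1) by simp
    qed
    ultimately have m: "m \<in> {1..n}" by simp
    have sub: "(\<Sum>l=1..n. g l (j l)) = (\<Sum>l=1..n - m + 1. g l (j l))"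
      if "\<And>l. g l 0 = 0" for g :: "nat \<Rightarrow> nat \<Rightarrow> nat"
      by (rule sum.mono_neutral_right)
        (use m that large_part_eq_0[OF m_def[symmetric] j(2)] in auto)
    have "j l \<le> m" if "l \<in> {1..n - m + 1}" for l
    proof -
      have "l \<in> {1..n}" using that m by auto
      then show ?thesis unfolding m_def by (intro member_le_sum) auto
    qed
    then have "restrict j {1..n - m + 1} \<in> bell_index n m"
      using j(2) sub[of "\<lambda>_ i. i", folded m_def] sub[of "\<lambda>l i. l * i"] m
      by (simp add: bell_index_def PiE_iff del: sum.cl_ivl_Suc)
    moreover have "cut j = (m, restrict j {1..n - m + 1})" by (simp add: cut_def m_def)
    ultimately show ?case using m by simp
  next
    case (5 p)
    then show ?case using prod_ext by auto
  qed
  finally show ?thesis .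
qed

section \<open>Generating function of the complete Bell polynomials\<close>

text \<open>Since the integer division is exact, it becomes division in the field, and the
  denominator can be distributed over the factors. They then have the shape found in the product of
  exponentials.\<close>

lemma partial_bell_field:
  fixes y :: "nat \<Rightarrow> 'a::field_char_0"
  shows "partial_bell n m y =
    fact n * (\<Sum>j\<in>bell_index n m. \<Prod>l=1..n - m + 1. (y l / fact l) ^ j l / fact (j l))"
  unfolding partial_bell_def sum_distrib_left
proof (rule sum.cong[OF refl])
  fix j assume j: "j \<in> bell_index n m"
  let ?L = "{1..n - m + 1}"
  have "of_nat (fact n div (\<Prod>l\<in>?L. fact (j l) * fact l ^ j l)) =
      (fact n / (\<Prod>l\<in>?L. fact (j l) * fact l ^ j l) :: 'a)"
  proof -
    let ?D = "\<Prod>l\<in>?L. fact (j l) * fact l ^ j l"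
    obtain q :: nat where q: "fact n = ?D * q" using bell_coeff_exact[OF j] by (elim dvdE)
    have "?D \<noteq> (0 :: nat)" by (simp del: prod.cl_ivl_Suc)
    then have "fact n div ?D = q" unfolding q by (rule nonzero_mult_div_cancel_left)
    moreover have "(fact n :: 'a) = ?D * of_nat q"
      using arg_cong[OF q, of "of_nat :: nat \<Rightarrow> 'a"] by (simp del: prod.cl_ivl_Suc)
    moreover have "?D \<noteq> (0 :: 'a)" by (simp del: prod.cl_ivl_Suc)
    ultimately show ?thesis by (simp del: prod.cl_ivl_Suc)
  qed
  moreover have "(\<Prod>l\<in>?L. (y l / fact l) ^ j l / fact (j l)) =
      (\<Prod>l\<in>?L. y l ^ j l) / (\<Prod>l\<in>?L. fact (j l) * fact l ^ j l)"
    unfolding prod_dividef[symmetric] by (simp add: power_divide mult.commute)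
  ultimately show "of_nat (fact n div (\<Prod>l\<in>?L. fact (j l) * fact l ^ j l)) * (\<Prod>l\<in>?L. y l ^ j l) =
      fact n * (\<Prod>l\<in>?L. (y l / fact l) ^ j l / fact (j l))"
    by simp
qed

theorem complete_bell_egf:
  fixes y :: "nat \<Rightarrow> 'a::field_char_0"
  shows "complete_bell n y =
    fact n * fps_nth (fps_exp 1 oo Abs_fps (\<lambda>l. if l = 0 then 0 else y l / fact l)) n"
proof (cases "n = 0")
  case True
  then show ?thesis by (simp add: complete_bell_def)
next
  case False
  \<comment> \<open>Truncating the exponent at degree n turns its exponential into a finite product
    without changing the n-th coefficient.\<close>
  let ?G = "\<Sum>l=1..n. fps_const (y l / fact l) * fps_X ^ l"
  have "complete_bell n y = fact n *
      (\<Sum>j\<in>weighted_families {1..n} n. \<Prod>l=1..n. (y l / fact l) ^ j l / fact (j l))"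
    using False sum_bell_index[of n "\<lambda>l i. (y l / fact l) ^ i / fact i"]
    by (simp add: complete_bell_def partial_bell_field sum_distrib_left[symmetric])
  also have "\<dots> = fact n * fps_nth (fps_exp 1 oo ?G) n"
    by (subst fps_exp_compose_sum, simp, simp, subst fps_prod_exp_monom_nth) simp_all
  also have "fps_nth (fps_exp 1 oo ?G) n =
      fps_nth (fps_exp 1 oo Abs_fps (\<lambda>l. if l = 0 then 0 else y l / fact l)) n"
    by (rule fps_compose_nth_cong)
      (auto simp: fps_sum_nth if_distrib[of "\<lambda>c. _ * c"] cong: if_cong)
  finally show ?thesis .
qed

section \<open>Evaluation at a real point and the umbral identity\<close>

text \<open>Evaluation is a ring homomorphism. This moves the claim from real polynomials, which are
  not a field, to the reals, where \<open>complete_bell_egf\<close> applies.\<close>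

lemma poly_complete_bell:
  fixes y :: "nat \<Rightarrow> 'a::comm_ring_1 poly"
  shows "poly (complete_bell k y) x = complete_bell k (\<lambda>n. poly (y n) x)"
  by (simp add: complete_bell_def partial_bell_def poly_sum poly_prod poly_power)

text \<open>The base is monic in the outer variable, so its k-th power has degree exactly k there,
  with coefficients given by the binomial theorem.\<close>

lemma poly_umbral_eval_binomial:
  "poly (umbral_eval m ([:[:0, 1:], 1:] ^ k)) x = (\<Sum>i\<le>k. of_nat (k choose i) * x ^ (k - i) * m i)"
  by (simp add: umbral_eval_def degree_linear_power coeff_linear_poly_power poly_sum poly_power ac_simps)

theorem proposition4p4:
  fixes a h :: "nat \<Rightarrow> real" and t :: real and k :: nat
  assumes "a 0 = 1"
    and "t \<ge> 0"
    and "formal_cumulants (umbral_dot (- t) a) h"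
  shows "Q k a t = complete_bell k (\<lambda>n. if n = 1 then [:0, 1:] + [:h 1:] else [:h n:])"
proof -
  let ?m = "umbral_dot (- t) a"
  define y where "y n = (if n = 1 then [:0, 1:] + [:h 1:] else [:h n:])" for n
  define G where "G = Abs_fps (\<lambda>l. if l = 0 then 0 else h l / fact l)"
  have "poly (Q k a t) x = poly (complete_bell k y) x" for x
  proof -
    \<comment> \<open>Only the coefficient at index 1, namely x + h 1, depends on x.\<close>
    have "Abs_fps (\<lambda>l. if l = 0 then 0 else poly (y l) x / fact l) = fps_const x * fps_X + G"
      by (rule fps_ext) (auto simp: G_def y_def add_divide_distrib le_Suc_eq)
    moreover have "fps_exp 1 oo (fps_const x * fps_X) = fps_exp x"
      by (simp add: fps_exp_compose_linear)
    moreover have "fps_exp 1 oo G = Abs_fps (\<lambda>n. ?m n / fact n)"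
      using assms(3) by (simp add: formal_cumulants_def G_def)
    ultimately have "poly (complete_bell k y) x =
        fact k * fps_nth (Abs_fps (\<lambda>n. ?m n / fact n) * fps_exp x) k"
      by (simp add: poly_complete_bell complete_bell_egf fps_exp_compose_add G_def mult.commute)
    also have "\<dots> = (\<Sum>i\<le>k. of_nat (k choose i) * x ^ (k - i) * ?m i)"
      unfolding fps_mult_nth sum_distrib_left atMost_atLeast0
      by (rule sum.cong) (simp_all add: binomial_fact)
    finally show ?thesis by (simp add: Q_def poly_umbral_eval_binomial)
  qed
  then have "Q k a t = complete_bell k y"
    \<comment> \<open>Real polynomials with equal values at every point are equal.\<close>
    by (simp add: poly_eq_poly_eq_iff[symmetric] fun_eq_iff)
  then show ?thesis by (simp only: y_def[abs_def])
qed

end
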